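(* Let $\rho>0$ and let $Q:\mathbb{R}\to\mathbb{R}$ be a function such that $x\mapsto Q(x)-\rho x^{2}$ is convex on $\mathbb{R}$. Put $I^{Q}:=\inf_{\mu\in\mathcal{P}(\mathbb{R})}E^{Q}(\mu)$, where $$E^{Q}(\mu)=\int Q(x)\,\mu(dx)-\iint\log|x-y|\,\mu(dx)\,\mu(dy).$$ If $\mu_{Q}\in\mathcal{P}(\mathbb{R})$ is a solution of this minimization problem (i.e. $E^{Q}(\mu_{Q})=I^{Q}$), then for every $\mu\in\mathcal{P}(\mathbb{R})$, $$\rho\,\bigl(W_{2}(\mu,\mu_{Q})\bigr)^{2}\le E^{Q}(\mu)-I^{Q}.$$ In particular, the minimization problem $\inf_{\mu\in\mathcal{P}(\mathbb{R})}E^{Q}(\mu)$ has a unique solution.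
   Context: $\mathcal{P}(\mathbb{R})$ is the set of all Borel probability measures on $\mathbb{R}$. The Wasserstein distance is $W_{2}(\mu,\nu)=\sqrt{\inf_{\pi\in\Pi(\mu,\nu)}\iint|x-y|^{2}\,d\pi(x,y)}$, where $\Pi(\mu,\nu)$ is the set of probability measures on $\mathbb{R}^{2}$ with marginals $\mu$ and $\nu$. The functional $E^{Q}$ takes values in $(-\infty,+\infty]$ and is understood as $\iint\bigl[\tfrac12(Q(x)+Q(y))-\log|x-y|\bigr]\mu(dx)\mu(dy)$, whose integrand is bounded below (with $-\log 0=+\infty$); the inequality is trivially true when $E^{Q}(\mu)=+\infty$, and $E^{Q}(\mu)<\infty$ forces $\mu$ to have finite second moment. *)

theory Defs
  imports "HOL-Probability.Probability"
begin

definition prob_measures :: "real measure set" where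
  "prob_measures = {\<mu>. real_distribution \<mu>}"

definition couplings :: "real measure \<Rightarrow> real measure \<Rightarrow> (real \<times> real) measure set" where
  "couplings \<mu> \<nu> = {\<pi>. prob_space \<pi> \<and> sets \<pi> = sets borel \<and>
     distr \<pi> borel fst = \<mu> \<and> distr \<pi> borel snd = \<nu>}"

definition ennreal_sqrt :: "ennreal \<Rightarrow> ennreal" where
  "ennreal_sqrt x = (if x = \<infinity> then \<infinity> else ennreal (sqrt (enn2real x)))"

text \<open>The value is \<open>\<infinity>\<close> when every coupling has infinite quadratic cost.\<close>

definition W2 :: "real measure \<Rightarrow> real measure \<Rightarrow> ennreal" where
  "W2 \<mu> \<nu> = ennreal_sqrt
     (INF \<pi>\<in>couplings \<mu> \<nu>. \<integral>\<^sup>+ (x, y). ennreal (\<bar>x - y\<bar>\<^sup>2) \<partial>\<pi>)"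

text \<open>
  Integral of an extended-real function as positive part minus negative part
  (\<open>e2ennreal\<close> sends negative values to \<open>0\<close>). It is meaningful when the
  integral of the negative part is finite, e.g. for a measurable function bounded below
  and a finite measure; its value is then in \<open>(-\<infinity>, \<infinity>]\<close>.
\<close>

definition ereal_integral :: "'a measure \<Rightarrow> ('a \<Rightarrow> ereal) \<Rightarrow> ereal" where
  "ereal_integral M f =
     enn2ereal (\<integral>\<^sup>+ z. e2ennreal (f z) \<partial>M) - enn2ereal (\<integral>\<^sup>+ z. e2ennreal (- f z) \<partial>M)"

text \<open>The convention \<open>- log 0 = \<infinity>\<close> is explicit, since \<open>ln 0 = 0\<close> in HOL.\<close>

definition neg_log_dist :: "real \<Rightarrow> real \<Rightarrow> ereal" where
  "neg_log_dist x y = (if x = y then \<infinity> else ereal (- ln \<bar>x - y\<bar>))"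

text \<open>
  The potential term is put under the double integral as \<open>(Q x + Q y) / 2\<close>:
  separately, \<open>\<integral> Q \<partial>\<mu>\<close> and the logarithmic energy may be \<open>\<infinity>\<close> and \<open>-\<infinity>\<close>.
\<close>

definition energy :: "(real \<Rightarrow> real) \<Rightarrow> real measure \<Rightarrow> ereal" where
  "energy Q \<mu> = ereal_integral (\<mu> \<Otimes>\<^sub>M \<mu>)
     (\<lambda>(x, y). ereal (1 / 2 * (Q x + Q y)) + neg_log_dist x y)"

definition min_energy :: "(real \<Rightarrow> real) \<Rightarrow> ereal" where
  "min_energy Q = (INF \<mu>\<in>prob_measures. energy Q \<mu>)"

end

theory Submission
  imports Defs
begin

text \<open>
  Write probability measures as laws of nondecreasing functions on \<open>(0,1)\<close>. If \<open>X\<close> and \<open>Y\<close>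
  are nondecreasing, then along \<open>(1 - t) X + t Y\<close> distances interpolate linearly, so convexity of
  \<open>- log\<close> and strong convexity of \<open>Q\<close> yield
  \<open>E((1 - t) X + t Y) + \<rho> t (1 - t) \<parallel>X - Y\<parallel>\<^sup>2 \<le> (1 - t) E(X) + t E(Y)\<close>
  with the norm of \<open>L\<^sup>2(0,1)\<close>. When \<open>X\<close> is minimal, dividing by \<open>t\<close> and letting \<open>t\<close> tend to
  \<open>0\<close> gives \<open>\<rho> \<parallel>X - Y\<parallel>\<^sup>2 \<le> E(Y) - E(X)\<close>, and \<open>(X, Y)\<close> is a coupling; uniqueness follows as well.
  With \<open>t = 1/2\<close> the same inequality makes minimizing sequences Cauchy in \<open>L\<^sup>2(0,1)\<close>, and Fatou's
  lemma along a fast one, which converges almost everywhere, produces a minimizer.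
\<close>

section \<open>Integrals of extended-real functions bounded below\<close>

text \<open>Integrate the pointwise identity \<open>split\<close>; the negative part integrates to
  at most \<open>C\<close>, so it can be cancelled. The energy thus becomes one nonnegative integral
  minus a constant, free of infinity minus infinity.\<close>

lemma ereal_integral_shift:
  fixes f :: "'a \<Rightarrow> ereal"
  assumes "prob_space M" and [measurable]: "f \<in> borel_measurable M"
    and lower: "\<And>z. - ereal C \<le> f z" and "0 \<le> C"
  shows "ereal_integral M f = enn2ereal (\<integral>\<^sup>+z. e2ennreal (f z + ereal C) \<partial>M) - ereal C"
proof -
  interpret prob_space M by fact
  let ?P = "\<integral>\<^sup>+z. e2ennreal (f z) \<partial>M" and ?N = "\<integral>\<^sup>+z. e2ennreal (- f z) \<partial>M"
    and ?S = "\<integral>\<^sup>+z. e2ennreal (f z + ereal C) \<partial>M"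
  have split: "e2ennreal (f z) + ennreal C = e2ennreal (f z + ereal C) + e2ennreal (- f z)" for z
    using lower[of z] \<open>0 \<le> C\<close>
    by (cases "f z"; cases "f z \<ge> 0")
      (auto simp: e2ennreal_neg ennreal_neg ennreal_plus[symmetric] simp del: ennreal_plus)
  have "?P + ennreal C = (\<integral>\<^sup>+z. e2ennreal (f z) + ennreal C \<partial>M)"
    by (subst nn_integral_add) (auto simp: emeasure_space_1)
  also have "\<dots> = ?S + ?N"
    unfolding split by (rule nn_integral_add) auto
  finally have *: "?P + ennreal C = ?S + ?N" .
  have "?N \<le> (\<integral>\<^sup>+z. ennreal C \<partial>M)"
  proof (rule nn_integral_mono)
    fix z
    show "e2ennreal (- f z) \<le> ennreal C"
      using lower[of z] e2ennreal_mono[of "- f z" "ereal C"] by (simp add: ereal_uminus_le_reorder)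
  qed
  then have "?N \<le> ennreal C"
    by (simp add: emeasure_space_1)
  then have "?N < \<infinity>"
    by (rule le_less_trans) simp
  then show ?thesis
    using * \<open>0 \<le> C\<close> unfolding ereal_integral_def
    by (cases ?P; cases ?N; cases ?S)
      (auto simp: ennreal_plus[symmetric] top_add simp del: ennreal_plus)
qed

section \<open>Convexity and lower semicontinuity of the shifted kernel\<close>

lemma neg_log_convex_combination:
  fixes a b t :: real
  assumes "0 < a" "0 < b" "0 < t" "t < 1"
  shows "- ln ((1 - t) * a + t * b) \<le> (1 - t) * (- ln a) + t * (- ln b)"
  using concave_onD[OF ln_concave, of t a b] assms by (simp add: algebra_simps)

lemma abs_convex_combination_same_sign:
  fixes a b t :: real
  assumes "0 \<le> a * b" "0 < t" "t < 1"
  shows "\<bar>(1 - t) * a + t * b\<bar> = (1 - t) * \<bar>a\<bar> + t * \<bar>b\<bar>"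
proof (cases "0 \<le> a \<and> 0 \<le> b")
  case True
  then show ?thesis using assms by simp
next
  case False
  then have "a \<le> 0 \<and> b \<le> 0"
    using assms(1) by (auto simp: zero_le_mult_iff)
  then have "(1 - t) * a \<le> 0" "t * b \<le> 0"
    using assms by (auto simp: mult_le_0_iff)
  then have "\<bar>(1 - t) * a + t * b\<bar> = - ((1 - t) * a + t * b)"
    by (intro abs_of_nonpos) simp
  then show ?thesis
    using \<open>a \<le> 0 \<and> b \<le> 0\<close> by simp
qed

text \<open>\<open>C\<close> lifts the energy integrand above zero, so that energies can be handled
  as \<open>ennreal\<close> integrals. \<open>ex_strongly_convex_potential\<close> supplies such a
  constant.\<close>

locale strongly_convex_potential =
  fixes Q :: "real \<Rightarrow> real" and \<rho> :: real and C :: real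
  assumes rho_pos: "\<rho> > 0"
    and convex: "convex_on UNIV (\<lambda>x. Q x - \<rho> * x\<^sup>2)"
    and C_nonneg: "0 \<le> C"
    and lower_bound: "x \<noteq> y \<Longrightarrow> 0 \<le> (Q x + Q y) / 2 - ln \<bar>x - y\<bar> + C"
begin

text \<open>By \<open>lower_bound\<close> the conversion to \<open>ennreal\<close> truncates nothing
  off the diagonal; the diagonal value is set by hand because \<open>ln 0 = 0\<close>.\<close>

definition kernel :: "real \<Rightarrow> real \<Rightarrow> ennreal" where
  "kernel x y = (if x = y then \<infinity> else ennreal ((Q x + Q y) / 2 - ln \<bar>x - y\<bar> + C))"

definition shifted_energy :: "real measure \<Rightarrow> ennreal" where
  "shifted_energy \<mu> = (\<integral>\<^sup>+(x, y). kernel x y \<partial>(\<mu> \<Otimes>\<^sub>M \<mu>))"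

lemma continuous_Q: "continuous_on UNIV Q"
proof -
  have "continuous_on UNIV (\<lambda>x. (Q x - \<rho> * x\<^sup>2) + \<rho> * x\<^sup>2)"
    by (intro continuous_intros convex_on_continuous[OF open_UNIV convex])
  then show ?thesis by simp
qed

lemma measurable_Q [measurable]: "Q \<in> borel_measurable borel"
  using continuous_Q by (rule borel_measurable_continuous_onI)

lemma measurable_kernel [measurable]:
  assumes [measurable]: "f \<in> borel_measurable M" "g \<in> borel_measurable M"
  shows "(\<lambda>x. kernel (f x) (g x)) \<in> borel_measurable M"
  unfolding kernel_def by measurable

text \<open>The quadratic gain comes from \<open>(1 - t) * x\<^sup>2 + t * y\<^sup>2 - ((1 - t) * x
  + t * y)\<^sup>2 = t * (1 - t) * (x - y)\<^sup>2\<close>.\<close>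

lemma Q_convex_combination:
  assumes "0 < t" "t < 1"
  shows "Q ((1 - t) * x + t * y) + \<rho> * t * (1 - t) * (x - y)\<^sup>2 \<le> (1 - t) * Q x + t * Q y"
proof -
  have "Q ((1 - t) * x + t * y) - \<rho> * ((1 - t) * x + t * y)\<^sup>2
      \<le> (1 - t) * (Q x - \<rho> * x\<^sup>2) + t * (Q y - \<rho> * y\<^sup>2)"
    using convex_onD[OF convex, of t x y] assms by simp
  then show ?thesis
    by (simp add: algebra_simps power2_eq_square)
qed

text \<open>Since the two differences do not have opposite signs, the distance interpolates linearly
  and the points do not collide on the way, so convexity of \<open>- ln\<close> applies.
  \<open>Q\<close> enters averaged over both points, hence the factor 1/2 in the gain.\<close>

lemma kernel_convex:
  assumes t: "0 < t" "t < 1" and order: "0 \<le> (x\<^sub>0 - y\<^sub>0) * (x\<^sub>1 - y\<^sub>1)"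
  shows "kernel ((1 - t) * x\<^sub>0 + t * x\<^sub>1) ((1 - t) * y\<^sub>0 + t * y\<^sub>1)
      + ennreal (\<rho> * t * (1 - t) / 2) * (ennreal ((x\<^sub>0 - x\<^sub>1)\<^sup>2) + ennreal ((y\<^sub>0 - y\<^sub>1)\<^sup>2))
    \<le> ennreal (1 - t) * kernel x\<^sub>0 y\<^sub>0 + ennreal t * kernel x\<^sub>1 y\<^sub>1"
proof (cases "x\<^sub>0 = y\<^sub>0 \<or> x\<^sub>1 = y\<^sub>1")
  case True
  \<comment> \<open>An infinite kernel with a positive weight makes the right-hand side
    infinite.\<close>
  then show ?thesis
    using t by (auto simp: kernel_def ennreal_mult_top)
next
  case False
  let ?x = "(1 - t) * x\<^sub>0 + t * x\<^sub>1" and ?y = "(1 - t) * y\<^sub>0 + t * y\<^sub>1"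
  let ?h = "\<lambda>x y. (Q x + Q y) / 2 - ln \<bar>x - y\<bar> + C"
  have diff: "?x - ?y = (1 - t) * (x\<^sub>0 - y\<^sub>0) + t * (x\<^sub>1 - y\<^sub>1)"
    by (simp add: algebra_simps)
  have dist: "\<bar>?x - ?y\<bar> = (1 - t) * \<bar>x\<^sub>0 - y\<^sub>0\<bar> + t * \<bar>x\<^sub>1 - y\<^sub>1\<bar>"
    unfolding diff using order t by (rule abs_convex_combination_same_sign)
  have "0 < (1 - t) * \<bar>x\<^sub>0 - y\<^sub>0\<bar> + t * \<bar>x\<^sub>1 - y\<^sub>1\<bar>"
    using False t by (intro add_pos_pos mult_pos_pos) auto
  then have ne: "?x \<noteq> ?y"
    using dist by auto
  have ln: "- ln \<bar>?x - ?y\<bar> \<le> (1 - t) * (- ln \<bar>x\<^sub>0 - y\<^sub>0\<bar>) + t * (- ln \<bar>x\<^sub>1 - y\<^sub>1\<bar>)"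
    unfolding dist using False t by (intro neg_log_convex_combination) auto
  have real: "?h ?x ?y + \<rho> * t * (1 - t) / 2 * ((x\<^sub>0 - x\<^sub>1)\<^sup>2 + (y\<^sub>0 - y\<^sub>1)\<^sup>2)
      \<le> (1 - t) * ?h x\<^sub>0 y\<^sub>0 + t * ?h x\<^sub>1 y\<^sub>1"
    using ln Q_convex_combination[OF t, of x\<^sub>0 x\<^sub>1] Q_convex_combination[OF t, of y\<^sub>0 y\<^sub>1]
    by (simp add: algebra_simps add_divide_distrib diff_divide_distrib)
  have nonneg: "0 \<le> ?h ?x ?y" "0 \<le> ?h x\<^sub>0 y\<^sub>0" "0 \<le> ?h x\<^sub>1 y\<^sub>1" "0 \<le> \<rho> * t * (1 - t) / 2"
    using lower_bound[OF ne] lower_bound[of x\<^sub>0 y\<^sub>0] lower_bound[of x\<^sub>1 y\<^sub>1] False t rho_pos by auto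
  have "ennreal (?h ?x ?y + \<rho> * t * (1 - t) / 2 * ((x\<^sub>0 - x\<^sub>1)\<^sup>2 + (y\<^sub>0 - y\<^sub>1)\<^sup>2))
      \<le> ennreal ((1 - t) * ?h x\<^sub>0 y\<^sub>0 + t * ?h x\<^sub>1 y\<^sub>1)"
    using real by (rule ennreal_leI)
  then show ?thesis
    using False ne nonneg t unfolding kernel_def
    by (simp only: if_False ennreal_plus ennreal_mult zero_le_power2 add_nonneg_nonneg
        mult_nonneg_nonneg diff_ge_0_iff_ge less_imp_le de_Morgan_disj)
qed

text \<open>Replacing the distance by its maximum with \<open>\<delta>\<close> gives a continuous
  minorant. Off the diagonal, \<open>\<delta>\<close> equal to the limiting distance loses nothing;
  on the diagonal, the minorants grow without bound as \<open>\<delta>\<close> shrinks.\<close>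

lemma kernel_lower_semicontinuous:
  assumes x: "x \<longlonglongrightarrow> x'" and y: "y \<longlonglongrightarrow> y'"
  shows "kernel x' y' \<le> liminf (\<lambda>n. kernel (x n) (y n))"
proof -
  have Q: "(\<lambda>n. Q (x n)) \<longlonglongrightarrow> Q x'" "(\<lambda>n. Q (y n)) \<longlonglongrightarrow> Q y'"
    using continuous_on_tendsto_compose[OF continuous_Q] x y by auto
  have trunc: "ennreal ((Q x' + Q y') / 2 - ln (max \<bar>x' - y'\<bar> \<delta>) + C)
      \<le> liminf (\<lambda>n. kernel (x n) (y n))" if "0 < \<delta>" for \<delta>
  proof -
    let ?f = "\<lambda>n. ennreal ((Q (x n) + Q (y n)) / 2 - ln (max \<bar>x n - y n\<bar> \<delta>) + C)"
    have "?f \<longlonglongrightarrow> ennreal ((Q x' + Q y') / 2 - ln (max \<bar>x' - y'\<bar> \<delta>) + C)"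
      using that by (intro tendsto_intros Q x y) auto
    then have "ennreal ((Q x' + Q y') / 2 - ln (max \<bar>x' - y'\<bar> \<delta>) + C) = liminf ?f"
      by (intro lim_imp_Liminf[symmetric]) auto
    also have "\<dots> \<le> liminf (\<lambda>n. kernel (x n) (y n))"
      using that by (intro Liminf_mono always_eventually) (auto simp: kernel_def intro!: ennreal_leI)
    finally show ?thesis .
  qed
  show ?thesis
  proof (cases "x' = y'")
    case False
    then show ?thesis
      using trunc[of "\<bar>x' - y'\<bar>"] by (simp add: kernel_def)
  next
    case True
    have "ennreal K \<le> liminf (\<lambda>n. kernel (x n) (y n))" for K
      \<comment> \<open>With this \<open>\<delta>\<close> the truncated value at the diagonal point
        is exactly \<open>K\<close>.\<close>
      using trunc[of "exp (Q x' + C - K)"] True by (simp add: max_absorb2)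
    note lower = this
    have "liminf (\<lambda>n. kernel (x n) (y n)) = \<infinity>"
    proof (cases "liminf (\<lambda>n. kernel (x n) (y n))")
      case (real r)
      then show ?thesis
        using lower[of "r + 1"] by simp
    qed simp
    then show ?thesis by simp
  qed
qed

text \<open>The product measure has mass 1, so shifting the integrand shifts the energy by the same
  constant and leaves the minimization problem unchanged.\<close>

lemma energy_eq:
  assumes "real_distribution \<mu>"
  shows "energy Q \<mu> = enn2ereal (shifted_energy \<mu>) - ereal C"
proof -
  interpret real_distribution \<mu> by fact
  interpret P: pair_prob_space \<mu> \<mu> ..
  let ?f = "\<lambda>(x, y). ereal (1 / 2 * (Q x + Q y)) + neg_log_dist x y"
  have meas: "?f \<in> borel_measurable (\<mu> \<Otimes>\<^sub>M \<mu>)"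
    unfolding neg_log_dist_def by measurable
  have "- ereal C \<le> ?f z" for z
    using lower_bound[of "fst z" "snd z"] by (auto simp: neg_log_dist_def split: prod.split)
  then have "energy Q \<mu> = enn2ereal (\<integral>\<^sup>+z. e2ennreal (?f z + ereal C) \<partial>(\<mu> \<Otimes>\<^sub>M \<mu>)) - ereal C"
    unfolding energy_def using C_nonneg by (intro ereal_integral_shift P.prob_space_axioms meas)
  also have "(\<lambda>z. e2ennreal (?f z + ereal C)) = (\<lambda>(x, y). kernel x y)"
    by (auto simp: fun_eq_iff kernel_def neg_log_dist_def)
  finally show ?thesis
    unfolding shifted_energy_def .
qed

end

section \<open>Laws of functions on the unit interval\<close>

text \<open>The interval is open so that quantile functions are finite at every point, also for laws
  with unbounded support.\<close>

abbreviation unit_interval :: "real measure" where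
  "unit_interval \<equiv> restrict_space lborel {0<..<1}"

interpretation unit_interval: prob_space unit_interval
  by (auto simp: space_restrict_space emeasure_restrict_space intro!: prob_spaceI)

interpretation unit_square: pair_prob_space unit_interval unit_interval ..

lemma real_distribution_distr:
  assumes [measurable]: "X \<in> borel_measurable unit_interval"
  shows "real_distribution (distr unit_interval borel X)"
  using unit_interval.real_distribution_distr[of X] by simp

text \<open>The witness \<open>I\<close> of \<open>cdf_distribution\<close> is the quantile
  function, the generalized inverse of the distribution function.\<close>

lemma ex_monotone_random_variable:
  assumes "real_distribution \<mu>"
  shows "\<exists>X\<in>borel_measurable unit_interval. mono_on {0<..<1} X \<and> distr unit_interval borel X = \<mu>"
proof -
  interpret cdf_distribution \<mu>
    using assms by (simp add: cdf_distribution_def)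
  have "I \<in> borel_measurable unit_interval"
    using measurable_CI by (simp add: measurable_def sets_restrict_space space_restrict_space)
  then show ?thesis
    using mono_I distr_I_eq_M by blast
qed

lemma nn_integral_unit_square_add:
  assumes [measurable]: "f \<in> borel_measurable unit_interval"
  shows "(\<integral>\<^sup>+(u, v). f u + f v \<partial>(unit_interval \<Otimes>\<^sub>M unit_interval)) = 2 * (\<integral>\<^sup>+u. f u \<partial>unit_interval)"
proof -
  have "(\<integral>\<^sup>+(u, v). f u + f v \<partial>(unit_interval \<Otimes>\<^sub>M unit_interval))
      = (\<integral>\<^sup>+u. (\<integral>\<^sup>+v. f u + f v \<partial>unit_interval) \<partial>unit_interval)"
    by (subst unit_interval.nn_integral_fst[symmetric]) auto
  also have "\<dots> = (\<integral>\<^sup>+u. f u + (\<integral>\<^sup>+v. f v \<partial>unit_interval) \<partial>unit_interval)"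
    by (subst nn_integral_add) (auto simp: emeasure_restrict_space)
  also have "\<dots> = 2 * (\<integral>\<^sup>+u. f u \<partial>unit_interval)"
    by (subst nn_integral_add) (auto simp: emeasure_restrict_space mult_2)
  finally show ?thesis .
qed

definition sq_dist :: "(real \<Rightarrow> real) \<Rightarrow> (real \<Rightarrow> real) \<Rightarrow> ennreal" where
  "sq_dist X Y = (\<integral>\<^sup>+u. ennreal ((X u - Y u)\<^sup>2) \<partial>unit_interval)"

text \<open>The joint law of \<open>X\<close> and \<open>Y\<close> is a coupling with cost
  \<open>sq_dist X Y\<close>, so it bounds the infimum.\<close>

lemma W2_distr_le:
  assumes [measurable]: "X \<in> borel_measurable unit_interval" "Y \<in> borel_measurable unit_interval"
    and "sq_dist X Y \<le> ennreal d" "0 \<le> d"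
  shows "(enn2ereal (W2 (distr unit_interval borel X) (distr unit_interval borel Y)))\<^sup>2 \<le> ereal d"
proof -
  let ?\<mu> = "distr unit_interval borel X" and ?\<nu> = "distr unit_interval borel Y"
  let ?\<pi> = "distr unit_interval borel (\<lambda>u. (X u, Y u))"
  let ?cost = "INF \<pi>\<in>couplings ?\<mu> ?\<nu>. \<integral>\<^sup>+(x, y). ennreal (\<bar>x - y\<bar>\<^sup>2) \<partial>\<pi>"
  \<comment> \<open>Couplings live on the Borel sets of the plane; \<open>borel_prod\<close>
    identifies these with the product sigma-algebra.\<close>
  have [measurable]: "(\<lambda>u. (X u, Y u)) \<in> borel_measurable unit_interval"
    unfolding borel_prod[symmetric] by measurable
  have [measurable]: "fst \<in> borel_measurable (borel :: (real \<times> real) measure)"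
    "snd \<in> borel_measurable (borel :: (real \<times> real) measure)"
    unfolding borel_prod[symmetric] by measurable
  have "?\<pi> \<in> couplings ?\<mu> ?\<nu>"
    unfolding couplings_def
    by (auto simp: distr_distr comp_def intro!: unit_interval.prob_space_distr)
  then have "?cost \<le> (\<integral>\<^sup>+(x, y). ennreal (\<bar>x - y\<bar>\<^sup>2) \<partial>?\<pi>)"
    by (rule INF_lower)
  also have "\<dots> = sq_dist X Y"
    unfolding sq_dist_def by (subst nn_integral_distr) (auto simp: borel_prod[symmetric])
  finally have cost: "?cost \<le> ennreal d"
    using assms(3) by (rule order_trans)
  \<comment> \<open>A finite infimum selects the finite branch of \<open>ennreal_sqrt\<close>, where
    squaring undoes the root.\<close>
  then obtain c where c: "?cost = ennreal c" "0 \<le> c"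
    by (cases ?cost) (auto simp: top_unique)
  then show ?thesis
    using cost \<open>0 \<le> d\<close> unfolding W2_def ennreal_sqrt_def by (simp add: ereal_power)
qed

section \<open>Convexity of the energy along monotone interpolation\<close>

context strongly_convex_potential
begin

text \<open>The product of the two laws is the image of the unit square under \<open>(u, v)\<close>
  to \<open>(X u, X v)\<close>. Energies of different measures thereby become integrals over one
  fixed space.\<close>

lemma shifted_energy_distr:
  assumes [measurable]: "X \<in> borel_measurable unit_interval"
  shows "shifted_energy (distr unit_interval borel X)
    = (\<integral>\<^sup>+(u, v). kernel (X u) (X v) \<partial>(unit_interval \<Otimes>\<^sub>M unit_interval))"
proof -
  interpret D: prob_space "distr unit_interval borel X"
    by (rule unit_interval.prob_space_distr) measurable
  have "distr unit_interval borel X \<Otimes>\<^sub>M distr unit_interval borel X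
      = distr (unit_interval \<Otimes>\<^sub>M unit_interval) (borel \<Otimes>\<^sub>M borel) (\<lambda>(u, v). (X u, X v))"
    by (rule pair_measure_distr) (auto intro: D.sigma_finite_measure_axioms)
  then show ?thesis
    unfolding shifted_energy_def
    by (simp add: nn_integral_distr) (auto intro!: nn_integral_cong)
qed

text \<open>This is \<open>kernel_convex\<close> integrated over the unit square; monotonicity
  provides its order condition.\<close>

lemma displacement_convexity:
  assumes [measurable]: "X \<in> borel_measurable unit_interval" "Y \<in> borel_measurable unit_interval"
    and mono: "mono_on {0<..<1} X" "mono_on {0<..<1} Y" and t: "0 < t" "t < 1"
  shows "shifted_energy (distr unit_interval borel (\<lambda>u. (1 - t) * X u + t * Y u))
      + ennreal (\<rho> * t * (1 - t)) * sq_dist X Y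
    \<le> ennreal (1 - t) * shifted_energy (distr unit_interval borel X)
      + ennreal t * shifted_energy (distr unit_interval borel Y)"
proof -
  let ?U2 = "unit_interval \<Otimes>\<^sub>M unit_interval"
  let ?Z = "\<lambda>u. (1 - t) * X u + t * Y u"
  let ?s = "\<lambda>u. ennreal ((X u - Y u)\<^sup>2)"
  have measurable_s: "?s \<in> borel_measurable unit_interval"
    by measurable
  have measurable_Z: "?Z \<in> borel_measurable unit_interval"
    by measurable
  let ?c = "ennreal (\<rho> * t * (1 - t) / 2)"
  \<comment> \<open>The half in \<open>?c\<close> is compensated because both coordinates contribute
    the same squared distance.\<close>
  have "ennreal (\<rho> * t * (1 - t)) = ?c * 2"
    using t rho_pos by (subst ennreal_numeral[symmetric], subst ennreal_mult[symmetric]) auto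
  then have "ennreal (\<rho> * t * (1 - t)) * sq_dist X Y = ?c * (2 * sq_dist X Y)"
    by (simp only: mult.assoc)
  also have "\<dots> = (\<integral>\<^sup>+(u, v). ?c * (?s u + ?s v) \<partial>?U2)"
    unfolding sq_dist_def nn_integral_unit_square_add[symmetric, OF measurable_s]
    by (subst nn_integral_cmult[symmetric]) (auto intro!: nn_integral_cong)
  finally have "shifted_energy (distr unit_interval borel ?Z) + ennreal (\<rho> * t * (1 - t)) * sq_dist X Y
      = (\<integral>\<^sup>+(u, v). kernel (?Z u) (?Z v) \<partial>?U2) + (\<integral>\<^sup>+(u, v). ?c * (?s u + ?s v) \<partial>?U2)"
    by (simp only: shifted_energy_distr[OF measurable_Z])
  also have "\<dots> = (\<integral>\<^sup>+(u, v). kernel (?Z u) (?Z v) + ?c * (?s u + ?s v) \<partial>?U2)"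
    by (subst nn_integral_add[symmetric]) (auto intro!: nn_integral_cong)
  also have "\<dots> \<le> (\<integral>\<^sup>+(u, v). ennreal (1 - t) * kernel (X u) (X v) + ennreal t * kernel (Y u) (Y v) \<partial>?U2)"
  proof (rule nn_integral_mono, clarify)
    fix u v assume "(u, v) \<in> space ?U2"
    then have uv: "u \<in> {0<..<1}" "v \<in> {0<..<1}"
      by (auto simp: space_pair_measure space_restrict_space)
    \<comment> \<open>Both functions are nondecreasing, so swapping \<open>u\<close> and
      \<open>v\<close> flips both differences together.\<close>
    have "0 \<le> (X u - X v) * (Y u - Y v)"
      using monotone_onD[OF mono(1)] monotone_onD[OF mono(2)] uv
      by (cases u v rule: le_cases) (auto simp: zero_le_mult_iff)
    then show "kernel (?Z u) (?Z v) + ?c * (?s u + ?s v)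
        \<le> ennreal (1 - t) * kernel (X u) (X v) + ennreal t * kernel (Y u) (Y v)"
      by (rule kernel_convex[OF t])
  qed
  also have "\<dots> = (\<integral>\<^sup>+(u, v). ennreal (1 - t) * kernel (X u) (X v) \<partial>?U2)
      + (\<integral>\<^sup>+(u, v). ennreal t * kernel (Y u) (Y v) \<partial>?U2)"
    by (subst nn_integral_add[symmetric]) (auto intro!: nn_integral_cong)
  also have "\<dots> = ennreal (1 - t) * shifted_energy (distr unit_interval borel X)
      + ennreal t * shifted_energy (distr unit_interval borel Y)"
    by (simp add: shifted_energy_distr split_beta' nn_integral_cmult)
  finally show ?thesis .
qed

end

section \<open>Almost everywhere convergence of fast Cauchy sequences\<close>

text \<open>The increments have summable integrals, so their sum is finite almost everywhere, and
  there the sequence telescopes to a convergent series.\<close>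

lemma AE_convergent_if_sq_dist_geometric:
  fixes X :: "nat \<Rightarrow> real \<Rightarrow> real"
  assumes [measurable]: "\<And>n. X n \<in> borel_measurable unit_interval"
    and dist: "\<And>n. sq_dist (X n) (X (Suc n)) \<le> ennreal ((1 / 4) ^ n)"
  shows "AE u in unit_interval. convergent (\<lambda>n. X n u)"
proof -
  let ?d = "\<lambda>n u. \<bar>X (Suc n) u - X n u\<bar>"
  have L1: "(\<integral>\<^sup>+u. ennreal (?d n u) \<partial>unit_interval) \<le> ennreal ((1 / 2) ^ n)" for n
  proof -
    \<comment> \<open>The bound \<open>d \<le> 1 / (2 * k) + k / 2 * d\<^sup>2\<close> takes the
      role of Cauchy-Schwarz; with squared distance at most \<open>1 / (k * k)\<close> both terms
      are at most \<open>1 / (2 * k)\<close>.\<close>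
    define k :: real where "k = 2 ^ n"
    have k: "0 < k" "(1 / 2) ^ n = 1 / k" "(1 / 4) ^ n = 1 / (k * k)"
      by (simp_all add: k_def power_one_over flip: power_mult_distrib)
    have "?d n u \<le> 1 / k / 2 + k / 2 * (X n u - X (Suc n) u)\<^sup>2" for u
    proof -
      have "0 \<le> (k * ?d n u - 1)\<^sup>2 / (2 * k)"
        using k by simp
      also have "\<dots> = k / 2 * (?d n u)\<^sup>2 - ?d n u + 1 / k / 2"
        using k by (simp add: power2_diff power_mult_distrib field_simps power2_eq_square)
      also have "(?d n u)\<^sup>2 = (X n u - X (Suc n) u)\<^sup>2"
        by (simp add: power2_commute)
      finally show ?thesis by simp
    qed
    then have "ennreal (?d n u)
        \<le> ennreal (1 / k / 2) + ennreal (k / 2) * ennreal ((X n u - X (Suc n) u)\<^sup>2)" for u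
      using k by (simp add: ennreal_mult[symmetric] ennreal_plus[symmetric] ennreal_leI del: ennreal_plus)
    then have "(\<integral>\<^sup>+u. ennreal (?d n u) \<partial>unit_interval)
        \<le> (\<integral>\<^sup>+u. ennreal (1 / k / 2) + ennreal (k / 2) * ennreal ((X n u - X (Suc n) u)\<^sup>2)
            \<partial>unit_interval)"
      by (intro nn_integral_mono) auto
    also have "\<dots> = ennreal (1 / k / 2) + ennreal (k / 2) * sq_dist (X n) (X (Suc n))"
      unfolding sq_dist_def
      by (subst nn_integral_add) (auto simp: nn_integral_cmult emeasure_restrict_space)
    also have "\<dots> \<le> ennreal (1 / k / 2) + ennreal (k / 2) * ennreal (1 / (k * k))"
      using dist[of n] by (intro add_left_mono mult_left_mono) (auto simp: k)
    also have "\<dots> = ennreal (1 / k / 2 + k / 2 * 1 / (k * k))"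
      using k by (simp add: ennreal_mult[symmetric] ennreal_plus[symmetric] del: ennreal_plus)
    also have "\<dots> = ennreal ((1 / 2) ^ n)"
      using k by (intro arg_cong[where f = ennreal]) (simp add: field_simps)
    finally show ?thesis .
  qed
  have "(\<integral>\<^sup>+u. (\<Sum>n. ennreal (?d n u)) \<partial>unit_interval) = (\<Sum>n. \<integral>\<^sup>+u. ennreal (?d n u) \<partial>unit_interval)"
    by (rule nn_integral_suminf) measurable
  also have "\<dots> \<le> (\<Sum>n. ennreal ((1 / 2) ^ n))"
    by (intro suminf_le L1) auto
  also have "\<dots> = ennreal (\<Sum>n. (1 / 2) ^ n)"
    by (intro suminf_ennreal2 summable_geometric) auto
  also have "\<dots> < \<infinity>"
    by simp
  finally have "(\<integral>\<^sup>+u. (\<Sum>n. ennreal (?d n u)) \<partial>unit_interval) \<noteq> \<infinity>"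
    by simp
  then have "AE u in unit_interval. (\<Sum>n. ennreal (?d n u)) \<noteq> \<infinity>"
    by (intro nn_integral_PInf_AE) auto
  then show ?thesis
  proof eventually_elim
    case (elim u)
    then have "summable (\<lambda>n. ?d n u)"
      by (intro summable_suminf_not_top) auto
    then have "summable (\<lambda>n. X (Suc n) u - X n u)"
      by (rule summable_rabs_cancel)
    then have "convergent (\<lambda>n. \<Sum>k<n. X (Suc k) u - X k u)"
      by (simp add: summable_iff_convergent)
    then have "convergent (\<lambda>n. (X n u - X 0 u) + X 0 u)"
      by (simp only: sum_lessThan_telescope[of "\<lambda>k. X k u"] convergent_add_const_right_iff)
    then show ?case by simp
  qed
qed

section \<open>A measure of finite energy\<close>

lemma measurable_unit_interval_ident: "(\<lambda>u. u) \<in> borel_measurable unit_interval"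
  by (intro measurable_restrict_space1) auto

lemma measurable_unit_square_fst_snd [measurable]:
  "fst \<in> borel_measurable (unit_interval \<Otimes>\<^sub>M unit_interval)"
  "snd \<in> borel_measurable (unit_interval \<Otimes>\<^sub>M unit_interval)"
  using measurable_compose[OF measurable_fst measurable_unit_interval_ident]
    measurable_compose[OF measurable_snd measurable_unit_interval_ident] by auto

lemma nn_integral_unit_square_inverse_sqrt_le:
  "(\<integral>\<^sup>+(u, v). ennreal (\<bar>u - v\<bar> powr (- (1/2))) \<partial>(unit_interval \<Otimes>\<^sub>M unit_interval)) \<le> 4"
proof -
  let ?k = "\<lambda>s::real. ennreal (s powr (- (1/2)) * indicator {0..1} s)"
  have k: "(\<integral>\<^sup>+s. ?k s \<partial>lborel) = 2"
  proof -
    have "(\<integral>\<^sup>+s. ?k s \<partial>lborel) = ennreal (1 powr (- (1/2) + 1) / (- (1/2) + 1))"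
    proof (rule nn_integral_has_integral_lborel)
      show "((\<lambda>s. s powr (- (1/2)) * indicator {0..1} s) has_integral
          1 powr (- (1/2) + 1) / (- (1/2) + 1)) (UNIV :: real set)"
      proof -
        have "((\<lambda>s. if s \<in> {0..1} then s powr (- (1/2)) else 0) has_integral
            1 powr (- (1/2) + 1) / (- (1/2) + 1)) (UNIV :: real set)"
          unfolding has_integral_restrict_UNIV by (rule has_integral_powr_from_0) auto
        also have "(\<lambda>s. if s \<in> {0..1} then s powr (- (1/2)) else 0)
            = (\<lambda>s::real. s powr (- (1/2)) * indicator {0..1} s)"
          by (auto simp: indicator_def fun_eq_iff)
        finally show ?thesis .
      qed
    qed auto
    also have "1 powr (- (1/2) + 1) / (- (1/2) + 1) = (2 :: real)"
      by simp
    finally show ?thesis by simp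
  qed
  have "(\<integral>\<^sup>+v. ennreal (\<bar>u - v\<bar> powr (- (1/2))) \<partial>unit_interval) \<le> 4" if "u \<in> {0<..<1}" for u
  proof -
    have "(\<integral>\<^sup>+v. ennreal (\<bar>u - v\<bar> powr (- (1/2))) \<partial>unit_interval)
        = (\<integral>\<^sup>+v. ennreal (\<bar>u - v\<bar> powr (- (1/2))) * indicator {0<..<1} v \<partial>lborel)"
      by (rule nn_integral_restrict_space) auto
    \<comment> \<open>The two terms cover the points left and right of \<open>u\<close>, at distance
      less than 1; each integrates to 2 because reflections and translations preserve Lebesgue
      measure.\<close>
    also have "\<dots> \<le> (\<integral>\<^sup>+v. ?k (u - v) + ?k (v - u) \<partial>lborel)"
      using that by (intro nn_integral_mono) (auto simp: indicator_def)
    also have "\<dots> = (\<integral>\<^sup>+v. ?k (u + (-1) * v) \<partial>lborel) + (\<integral>\<^sup>+v. ?k (- u + 1 * v) \<partial>lborel)"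
      by (subst nn_integral_add) auto
    also have "\<dots> = 2 + 2"
    proof -
      have "(\<integral>\<^sup>+v. ?k (t + c * v) \<partial>lborel) = 2" if "\<bar>c\<bar> = 1" for t c
      proof -
        have "2 = ennreal \<bar>c\<bar> * (\<integral>\<^sup>+v. ?k (t + c * v) \<partial>lborel)"
          unfolding k[symmetric] using that by (intro nn_integral_real_affine) auto
        then show ?thesis
          unfolding that by (simp only: ennreal_1 mult_1_left)
      qed
      then show ?thesis
        by (intro arg_cong2[where f = "(+)"]) (simp_all only: abs_minus_cancel abs_one)
    qed
    finally show ?thesis by simp
  qed
  then have "(\<integral>\<^sup>+u. (\<integral>\<^sup>+v. ennreal (\<bar>u - v\<bar> powr (- (1/2))) \<partial>unit_interval) \<partial>unit_interval)
      \<le> (\<integral>\<^sup>+u. 4 \<partial>unit_interval)"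
    by (intro nn_integral_mono) (auto simp: space_restrict_space)
  also have "\<dots> = 4"
    by (simp add: emeasure_restrict_space)
  finally show ?thesis
    by (subst unit_interval.nn_integral_fst[symmetric]) (auto simp: split_beta')
qed

text \<open>This is \<open>ln s \<le> s - 1\<close> at \<open>s = r powr (- (1/2))\<close>; the
  exponent keeps the dominating singularity integrable.\<close>

lemma neg_ln_le_powr:
  fixes r :: real
  assumes "0 < r"
  shows "- ln r \<le> 2 * r powr (- (1/2))"
proof -
  have "ln (r powr (- (1/2))) \<le> r powr (- (1/2)) - 1"
    using assms by (intro ln_le_minus_one) simp
  then show ?thesis
    using assms by (simp add: ln_powr)
qed

context strongly_convex_potential
begin

text \<open>The uniform law on the unit interval works: \<open>Q\<close> is bounded there, and the
  logarithmic singularity is dominated by an inverse square root.\<close>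

lemma ex_finite_shifted_energy:
  "\<exists>\<mu>\<in>prob_measures. shifted_energy \<mu> < \<infinity>"
proof -
  let ?U2 = "unit_interval \<Otimes>\<^sub>M unit_interval" and ?\<mu> = "distr unit_interval borel (\<lambda>u. u)"
  note measurable_unit_interval_ident [measurable]
  have "bounded (Q ` {0..1})"
    by (intro compact_imp_bounded compact_continuous_image continuous_on_subset[OF continuous_Q]) auto
  then obtain B where B: "\<And>x. x \<in> {0..1} \<Longrightarrow> \<bar>Q x\<bar> \<le> B"
    unfolding bounded_iff by fastforce
  have "0 \<le> B"
    using B[of 0] by simp
  \<comment> \<open>The kernel is infinite on the diagonal, which is null because singletons
    are.\<close>
  have diag: "AE z in ?U2. fst z \<noteq> snd z"
  proof (rule unit_square.AE_pair_measure)
    show "{z \<in> space ?U2. fst z \<noteq> snd z} \<in> sets ?U2"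
      by measurable
    show "AE u in unit_interval. AE v in unit_interval. fst (u, v) \<noteq> snd (u, v)"
    proof (rule AE_I2)
      fix u
      show "AE v in unit_interval. fst (u, v) \<noteq> snd (u, v)"
        using AE_lborel_singleton[of u] by (auto simp: AE_restrict_space_iff)
    qed
  qed
  have "shifted_energy ?\<mu> = (\<integral>\<^sup>+(u, v). kernel u v \<partial>?U2)"
    by (rule shifted_energy_distr) measurable
  also have "\<dots> \<le> (\<integral>\<^sup>+(u, v). ennreal (B + C) + 2 * ennreal (\<bar>u - v\<bar> powr (- (1/2))) \<partial>?U2)"
  proof (rule nn_integral_mono_AE, use diag AE_space[of ?U2] in eventually_elim)
    case (elim z)
    obtain u v where z: "z = (u, v)" by (cases z)
    have uv: "u \<noteq> v" "u \<in> {0..1}" "v \<in> {0..1}"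
      using elim by (auto simp: z space_pair_measure space_restrict_space)
    have "(Q u + Q v) / 2 - ln \<bar>u - v\<bar> + C \<le> (B + C) + 2 * \<bar>u - v\<bar> powr (- (1/2))"
    proof -
      have "Q u \<le> B" "Q v \<le> B" "- ln \<bar>u - v\<bar> \<le> 2 * \<bar>u - v\<bar> powr (- (1/2))"
        using B[of u] B[of v] neg_ln_le_powr[of "\<bar>u - v\<bar>"] uv by auto
      then show ?thesis by argo
    qed
    then have "kernel u v \<le> ennreal ((B + C) + 2 * \<bar>u - v\<bar> powr (- (1/2)))"
      using uv by (simp add: kernel_def ennreal_leI)
    also have "\<dots> = ennreal (B + C) + 2 * ennreal (\<bar>u - v\<bar> powr (- (1/2)))"
      using \<open>0 \<le> B\<close> C_nonneg by (simp add: ennreal_mult)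
    finally show ?case
      by (simp add: z)
  qed
  also have "\<dots> = ennreal (B + C) + 2 * (\<integral>\<^sup>+(u, v). ennreal (\<bar>u - v\<bar> powr (- (1/2))) \<partial>?U2)"
    by (simp add: split_beta' nn_integral_add nn_integral_cmult unit_square.emeasure_space_1)
  also have "\<dots> \<le> ennreal (B + C) + 2 * 4"
    by (intro add_left_mono mult_left_mono nn_integral_unit_square_inverse_sqrt_le) auto
  also have "\<dots> < \<infinity>"
    by (simp add: ennreal_mult_less_top)
  finally show ?thesis
    unfolding prob_measures_def using real_distribution_distr[OF measurable_unit_interval_ident] by blast
qed

section \<open>Existence of a minimizer\<close>

text \<open>Convergence holds in both coordinates almost everywhere on the square; pointwise
  semicontinuity of the kernel and Fatou's lemma then apply.\<close>

lemma shifted_energy_lower_semicontinuous: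
  assumes [measurable]: "\<And>n. X n \<in> borel_measurable unit_interval" "Y \<in> borel_measurable unit_interval"
    and lim: "AE u in unit_interval. (\<lambda>n. X n u) \<longlonglongrightarrow> Y u"
  shows "shifted_energy (distr unit_interval borel Y)
    \<le> liminf (\<lambda>n. shifted_energy (distr unit_interval borel (X n)))"
proof -
  let ?U2 = "unit_interval \<Otimes>\<^sub>M unit_interval"
  have "AE z in ?U2. (\<lambda>n. X n (fst z)) \<longlonglongrightarrow> Y (fst z) \<and> (\<lambda>n. X n (snd z)) \<longlonglongrightarrow> Y (snd z)"
    (is "AE z in ?U2. ?P z")
  proof (rule unit_square.AE_pair_measure)
    show "{z \<in> space ?U2. ?P z} \<in> sets ?U2"
      by measurable
    show "AE u in unit_interval. AE v in unit_interval. ?P (u, v)"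
      using lim by eventually_elim (use lim in simp)
  qed
  then have "(\<integral>\<^sup>+(u, v). kernel (Y u) (Y v) \<partial>?U2)
      \<le> (\<integral>\<^sup>+z. liminf (\<lambda>n. kernel (X n (fst z)) (X n (snd z))) \<partial>?U2)"
    by (intro nn_integral_mono_AE, eventually_elim)
      (auto simp: split_beta' intro: kernel_lower_semicontinuous)
  also have "\<dots> \<le> liminf (\<lambda>n. \<integral>\<^sup>+z. kernel (X n (fst z)) (X n (snd z)) \<partial>?U2)"
    by (rule nn_integral_liminf) measurable
  finally show ?thesis
    by (simp add: shifted_energy_distr split_beta')
qed

lemma ex_minimizer:
  "\<exists>\<mu>\<in>prob_measures. shifted_energy \<mu> < \<infinity> \<and> (\<forall>\<nu>\<in>prob_measures. shifted_energy \<mu> \<le> shifted_energy \<nu>)"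
proof -
  define m where "m = (INF \<nu>\<in>prob_measures. shifted_energy \<nu>)"
  have m_le: "m \<le> shifted_energy \<nu>" if "\<nu> \<in> prob_measures" for \<nu>
    unfolding m_def using that by (rule INF_lower)
  have "m < \<infinity>"
    using ex_finite_shifted_energy m_le le_less_trans by blast
  \<comment> \<open>The factor \<open>\<rho> / 4\<close> is the gain coefficient
    \<open>\<rho> * t * (1 - t)\<close> at \<open>t = 1 / 2\<close>, so dividing by it leaves the
    geometric bound required for convergence.\<close>
  define \<epsilon> where "\<epsilon> n = \<rho> / 4 * (1 / 4) ^ n" for n :: nat
  have \<epsilon>: "0 < \<epsilon> n" for n
    using rho_pos by (simp add: \<epsilon>_def)
  have "\<exists>X\<in>borel_measurable unit_interval. mono_on {0<..<1} X \<and>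
      shifted_energy (distr unit_interval borel X) \<le> m + ennreal (\<epsilon> n)" for n
  proof -
    have "m < m + ennreal (\<epsilon> n)"
      using \<open>m < \<infinity>\<close> \<epsilon>[of n] by (simp add: ennreal_add_left_cancel_less)
    then obtain \<nu> where "\<nu> \<in> prob_measures" "shifted_energy \<nu> < m + ennreal (\<epsilon> n)"
      unfolding m_def INF_less_iff by blast
    then show ?thesis
      using ex_monotone_random_variable[of \<nu>] by (fastforce simp: prob_measures_def less_imp_le)
  qed
  then obtain X where X [measurable]: "\<And>n. X n \<in> borel_measurable unit_interval"
    and mono: "\<And>n. mono_on {0<..<1} (X n)"
    and near: "\<And>n. shifted_energy (distr unit_interval borel (X n)) \<le> m + ennreal (\<epsilon> n)"
    by metis
  have dist: "sq_dist (X n) (X (Suc n)) \<le> ennreal ((1 / 4) ^ n)" for n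
  proof -
    let ?Z = "\<lambda>u. (1 - 1 / 2) * X n u + 1 / 2 * X (Suc n) u"
    have "\<epsilon> (Suc n) \<le> \<epsilon> n"
      using rho_pos by (simp add: \<epsilon>_def)
    then have "m + ennreal (\<epsilon> (Suc n)) \<le> m + ennreal (\<epsilon> n)"
      by (intro add_left_mono ennreal_leI)
    then have near': "shifted_energy (distr unit_interval borel (X (Suc n))) \<le> m + ennreal (\<epsilon> n)"
      using near[of "Suc n"] by (rule order_trans[rotated])
    \<comment> \<open>The midpoint law has energy at least \<open>m\<close>, while its endpoints are
      within \<open>\<epsilon> n\<close> of \<open>m\<close>; finiteness of \<open>m\<close> lets it
      be cancelled, leaving a bound on the gain.\<close>
    have "m + ennreal (\<rho> / 4) * sq_dist (X n) (X (Suc n))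
        \<le> shifted_energy (distr unit_interval borel ?Z)
          + ennreal (\<rho> * (1 / 2) * (1 - 1 / 2)) * sq_dist (X n) (X (Suc n))"
      using real_distribution_distr[of ?Z]
      by (intro add_mono m_le) (auto simp: prob_measures_def)
    also have "\<dots> \<le> ennreal (1 - 1 / 2) * shifted_energy (distr unit_interval borel (X n))
        + ennreal (1 / 2) * shifted_energy (distr unit_interval borel (X (Suc n)))"
      by (rule displacement_convexity) (auto intro: mono)
    also have "\<dots> \<le> ennreal (1 - 1 / 2) * (m + ennreal (\<epsilon> n)) + ennreal (1 / 2) * (m + ennreal (\<epsilon> n))"
      by (intro add_mono mult_left_mono near near') auto
    also have "\<dots> = m + ennreal (\<epsilon> n)"
      unfolding distrib_right[symmetric] by (subst ennreal_plus[symmetric]) auto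
    finally have "ennreal (\<rho> / 4) * sq_dist (X n) (X (Suc n)) \<le> ennreal (\<epsilon> n)"
      using \<open>m < \<infinity>\<close> by (auto simp: ennreal_add_left_cancel_le)
    also have "ennreal (\<epsilon> n) = ennreal (\<rho> / 4) * ennreal ((1 / 4) ^ n)"
      using rho_pos by (subst ennreal_mult[symmetric]) (auto simp: \<epsilon>_def)
    finally show ?thesis
      using rho_pos by (subst (asm) ennreal_mult_le_mult_iff) auto
  qed
  \<comment> \<open>\<open>lim\<close> gives a measurable function on the whole interval; its values
    where the sequence diverges affect only a null set.\<close>
  define Y where "Y u = lim (\<lambda>n. X n u)" for u
  have [measurable]: "Y \<in> borel_measurable unit_interval"
    unfolding Y_def by measurable
  have "AE u in unit_interval. (\<lambda>n. X n u) \<longlonglongrightarrow> Y u"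
    using AE_convergent_if_sq_dist_geometric[of X, OF X dist]
    by eventually_elim (simp add: Y_def convergent_LIMSEQ_iff)
  then have "shifted_energy (distr unit_interval borel Y)
      \<le> liminf (\<lambda>n. shifted_energy (distr unit_interval borel (X n)))"
    by (intro shifted_energy_lower_semicontinuous) auto
  also have "\<dots> \<le> liminf (\<lambda>n. m + ennreal (\<epsilon> n))"
    by (intro Liminf_mono always_eventually allI near)
  also have "\<dots> = m + ennreal 0"
  proof (rule lim_imp_Liminf)
    have "\<epsilon> \<longlonglongrightarrow> \<rho> / 4 * 0"
      unfolding \<epsilon>_def[abs_def] by (intro tendsto_intros LIMSEQ_realpow_zero) auto
    then show "(\<lambda>n. m + ennreal (\<epsilon> n)) \<longlonglongrightarrow> m + ennreal 0"
      by (intro tendsto_intros) auto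
  qed simp
  finally have "shifted_energy (distr unit_interval borel Y) \<le> m"
    by simp
  moreover have "distr unit_interval borel Y \<in> prob_measures"
    using real_distribution_distr[of Y] by (simp add: prob_measures_def)
  ultimately show ?thesis
    using m_le \<open>m < \<infinity>\<close> by (meson le_less_trans order_trans)
qed

section \<open>Transport inequality and uniqueness\<close>

text \<open>Interpolated laws have energy at least \<open>m\<close>, so convexity bounds the gain by
  \<open>t * (e - m)\<close>; divide by \<open>t\<close> and let it tend to 0.\<close>

lemma sq_dist_minimizer_le:
  assumes [measurable]: "X \<in> borel_measurable unit_interval" "Y \<in> borel_measurable unit_interval"
    and mono: "mono_on {0<..<1} X" "mono_on {0<..<1} Y"
    and minimal: "\<And>\<nu>. \<nu> \<in> prob_measures \<Longrightarrow> shifted_energy (distr unit_interval borel X) \<le> shifted_energy \<nu>"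
    and X: "shifted_energy (distr unit_interval borel X) = ennreal m" "0 \<le> m"
    and Y: "shifted_energy (distr unit_interval borel Y) = ennreal e" "0 \<le> e"
  shows "sq_dist X Y \<le> ennreal ((e - m) / \<rho>)"
proof -
  have *: "ennreal m + ennreal (\<rho> * t * (1 - t)) * sq_dist X Y \<le> ennreal ((1 - t) * m + t * e)"
    if t: "0 < t" "t < 1" for t
  proof -
    let ?Z = "\<lambda>u. (1 - t) * X u + t * Y u"
    have "ennreal m \<le> shifted_energy (distr unit_interval borel ?Z)"
      unfolding X(1)[symmetric] using real_distribution_distr[of ?Z]
      by (intro minimal) (simp add: prob_measures_def)
    then have "ennreal m + ennreal (\<rho> * t * (1 - t)) * sq_dist X Y
        \<le> shifted_energy (distr unit_interval borel ?Z) + ennreal (\<rho> * t * (1 - t)) * sq_dist X Y"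
      by (rule add_right_mono)
    also have "\<dots> \<le> ennreal (1 - t) * ennreal m + ennreal t * ennreal e"
      unfolding X(1)[symmetric] Y(1)[symmetric] by (intro displacement_convexity mono t) auto
    also have "\<dots> = ennreal ((1 - t) * m + t * e)"
      using t X(2) Y(2) by (simp add: ennreal_mult)
    finally show ?thesis .
  qed
  show ?thesis
  proof (cases "sq_dist X Y")
    case (real d)
    \<comment> \<open>Here \<open>z = 1 - t\<close>, and the limit becomes \<open>z\<close> tending
      to 1, handled by \<open>field_le_mult_one_interval\<close>.\<close>
    have "z * (\<rho> * d) \<le> e - m" if z: "0 < z" "z < 1" for z
    proof -
      have "ennreal (m + \<rho> * (1 - z) * z * d) \<le> ennreal (z * m + (1 - z) * e)"
        using *[of "1 - z"] z rho_pos X(2) real by (simp add: ennreal_mult)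
      then have "m + \<rho> * (1 - z) * z * d \<le> z * m + (1 - z) * e"
        using z X(2) Y(2) by (subst (asm) ennreal_le_iff) auto
      then have "(1 - z) * (z * (\<rho> * d)) \<le> (1 - z) * (e - m)"
        by (simp add: algebra_simps)
      then show ?thesis
        using z by simp
    qed
    then have "\<rho> * d \<le> e - m"
      by (rule field_le_mult_one_interval)
    then show ?thesis
      using real rho_pos by (auto simp: field_simps intro!: ennreal_leI)
  next
    \<comment> \<open>An infinite distance would give an infinite left-hand side in \<open>*\<close>
      against a real bound.\<close>
    case top
    then show ?thesis
      using *[of "1 / 2"] rho_pos by (simp add: ennreal_mult_top top_unique)
  qed
qed

text \<open>With equal energies the distance estimate reads \<open>sq_dist X Y \<le> 0\<close>, so
  the quantile functions agree almost everywhere and have the same law.\<close>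

lemma minimizer_unique:
  assumes "\<mu> \<in> prob_measures" "\<nu> \<in> prob_measures"
    and minimal: "\<And>\<kappa>. \<kappa> \<in> prob_measures \<Longrightarrow> shifted_energy \<mu> \<le> shifted_energy \<kappa>"
    and eq: "shifted_energy \<nu> = shifted_energy \<mu>" and "shifted_energy \<mu> < \<infinity>"
  shows "\<mu> = \<nu>"
proof -
  obtain X where X [measurable]: "X \<in> borel_measurable unit_interval"
    "mono_on {0<..<1} X" "distr unit_interval borel X = \<mu>"
    using ex_monotone_random_variable[of \<mu>] assms(1) by (auto simp: prob_measures_def)
  obtain Y where Y [measurable]: "Y \<in> borel_measurable unit_interval"
    "mono_on {0<..<1} Y" "distr unit_interval borel Y = \<nu>"
    using ex_monotone_random_variable[of \<nu>] assms(2) by (auto simp: prob_measures_def)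
  obtain m where "shifted_energy \<mu> = ennreal m" "0 \<le> m"
    using \<open>shifted_energy \<mu> < \<infinity>\<close> by (cases "shifted_energy \<mu>") auto
  then have "sq_dist X Y \<le> ennreal ((m - m) / \<rho>)"
    using minimal eq by (intro sq_dist_minimizer_le X Y) (auto simp: X Y)
  then have "(\<integral>\<^sup>+u. ennreal ((X u - Y u)\<^sup>2) \<partial>unit_interval) = 0"
    by (simp add: sq_dist_def)
  then have "AE u in unit_interval. X u = Y u"
    by (subst (asm) nn_integral_0_iff_AE) (auto simp: ennreal_eq_0_iff)
  then have "distr unit_interval borel X = distr unit_interval borel Y"
    using X(1) Y(1) by (intro distr_cong_AE) auto
  then show ?thesis
    by (simp add: X Y)
qed

lemma transport_inequality:
  assumes "\<mu>\<^sub>0 \<in> prob_measures" "\<mu> \<in> prob_measures"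
    and minimal: "\<And>\<kappa>. \<kappa> \<in> prob_measures \<Longrightarrow> shifted_energy \<mu>\<^sub>0 \<le> shifted_energy \<kappa>"
    and finite: "shifted_energy \<mu>\<^sub>0 < \<infinity>"
  shows "ereal \<rho> * (enn2ereal (W2 \<mu> \<mu>\<^sub>0))\<^sup>2 \<le> energy Q \<mu> - energy Q \<mu>\<^sub>0"
proof -
  obtain m where m: "shifted_energy \<mu>\<^sub>0 = ennreal m" "0 \<le> m"
    using finite by (cases "shifted_energy \<mu>\<^sub>0") auto
  have energy: "energy Q \<mu>\<^sub>0 = ereal (m - C)"
    using assms(1) m by (simp add: prob_measures_def energy_eq)
  show ?thesis
  proof (cases "shifted_energy \<mu>")
    case (real e)
    obtain X where X: "X \<in> borel_measurable unit_interval"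
      "mono_on {0<..<1} X" "distr unit_interval borel X = \<mu>\<^sub>0"
      using ex_monotone_random_variable[of \<mu>\<^sub>0] assms(1) by (auto simp: prob_measures_def)
    obtain Y where Y: "Y \<in> borel_measurable unit_interval"
      "mono_on {0<..<1} Y" "distr unit_interval borel Y = \<mu>"
      using ex_monotone_random_variable[of \<mu>] assms(2) by (auto simp: prob_measures_def)
    have "sq_dist X Y \<le> ennreal ((e - m) / \<rho>)"
      using minimal m real by (intro sq_dist_minimizer_le X Y) (auto simp: X Y)
    then have dist: "sq_dist Y X \<le> ennreal ((e - m) / \<rho>)"
      by (simp add: sq_dist_def power2_commute)
    \<comment> \<open>\<open>W2_distr_le\<close> asks for a nonnegative real bound.\<close>
    have "m \<le> e"
      using minimal[OF assms(2)] m real by simp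
    then have "(enn2ereal (W2 \<mu> \<mu>\<^sub>0))\<^sup>2 \<le> ereal ((e - m) / \<rho>)"
      using W2_distr_le[OF Y(1) X(1) dist] rho_pos by (simp add: X Y)
    then have "ereal \<rho> * (enn2ereal (W2 \<mu> \<mu>\<^sub>0))\<^sup>2 \<le> ereal \<rho> * ereal ((e - m) / \<rho>)"
      using rho_pos by (intro ereal_mult_left_mono) auto
    also have "\<dots> = energy Q \<mu> - energy Q \<mu>\<^sub>0"
      using real assms(2) rho_pos energy by (simp add: prob_measures_def energy_eq)
    finally show ?thesis .
  next
    \<comment> \<open>The right-hand side is infinite, as the energy of \<open>\<mu>\<^sub>0\<close>
      is real.\<close>
    case top
    then show ?thesis
      using assms(2) energy by (simp add: prob_measures_def energy_eq)
  qed
qed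

lemma energy_le_iff:
  assumes "\<mu> \<in> prob_measures" "\<nu> \<in> prob_measures"
  shows "energy Q \<mu> \<le> energy Q \<nu> \<longleftrightarrow> shifted_energy \<mu> \<le> shifted_energy \<nu>"
  using assms unfolding prob_measures_def
  by (cases "shifted_energy \<mu>"; cases "shifted_energy \<nu>") (auto simp: energy_eq top_unique)

end

section \<open>Lower bound for the kernel and conclusion\<close>

text \<open>
  A supporting line at \<open>0\<close> gives \<open>Q x \<ge> \<rho> * x\<^sup>2 + b * x + Q 0\<close>; half of the quadratic term
  absorbs \<open>ln \<bar>x - y\<bar>\<close>, the other half absorbs the linear term.
\<close>

lemma ex_strongly_convex_potential:
  fixes Q :: "real \<Rightarrow> real"
  assumes "\<rho> > 0" and conv: "convex_on UNIV (\<lambda>x. Q x - \<rho> * x\<^sup>2)"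
  shows "\<exists>C. strongly_convex_potential Q \<rho> C"
proof -
  obtain b where b: "\<And>x. Q 0 + b * x \<le> Q x - \<rho> * x\<^sup>2"
    using convex_le_Inf_differential[OF conv, of 0] by fastforce
  \<comment> \<open>The terms pay for the two completed squares, the height of the supporting line
    and the constant in the logarithmic bound.\<close>
  define K where "K = b\<^sup>2 / (2 * \<rho>) - Q 0 - (1 + ln (\<rho> / 4)) / 2"
  have "0 \<le> (Q x + Q y) / 2 - ln \<bar>x - y\<bar> + max 0 K" if "x \<noteq> y" for x y
  proof -
    have square: "0 \<le> \<rho> / 4 * z\<^sup>2 + b / 2 * z + b\<^sup>2 / (4 * \<rho>)" for z
    proof -
      have "0 \<le> \<rho> / 4 * (z + b / \<rho>)\<^sup>2"
        using \<open>\<rho> > 0\<close> by simp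
      also have "\<dots> = \<rho> / 4 * z\<^sup>2 + b / 2 * z + b\<^sup>2 / (4 * \<rho>)"
        using \<open>\<rho> > 0\<close> by (simp add: power2_eq_square field_simps)
      finally show ?thesis .
    qed
    \<comment> \<open>This scaling makes \<open>ln \<bar>x - y\<bar>\<close> cost
      \<open>\<rho> / 4\<close> per square, half of the \<open>\<rho> / 2\<close> that averaging
      \<open>Q\<close> provides.\<close>
    have "ln (\<rho> / 4 * \<bar>x - y\<bar>\<^sup>2) \<le> \<rho> / 4 * \<bar>x - y\<bar>\<^sup>2 - 1"
      using that \<open>\<rho> > 0\<close> by (intro ln_le_minus_one) auto
    moreover have "ln (\<rho> / 4 * \<bar>x - y\<bar>\<^sup>2) = ln (\<rho> / 4) + 2 * ln \<bar>x - y\<bar>"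
    proof -
      have "ln (\<rho> / 4 * r\<^sup>2) = ln (\<rho> / 4) + 2 * ln r" if "0 < r" for r
        using that \<open>\<rho> > 0\<close> by (subst ln_mult) (simp_all add: ln_realpow)
      then show ?thesis
        using that by (metis zero_less_abs_iff right_minus_eq)
    qed
    moreover have "\<rho> / 4 * \<bar>x - y\<bar>\<^sup>2 \<le> \<rho> / 4 * (2 * x\<^sup>2 + 2 * y\<^sup>2)"
      using \<open>\<rho> > 0\<close> zero_le_power2[of "x + y"]
      by (intro mult_left_mono) (auto simp: power2_eq_square algebra_simps)
    ultimately have "ln \<bar>x - y\<bar> \<le> \<rho> / 4 * x\<^sup>2 + \<rho> / 4 * y\<^sup>2 - (1 + ln (\<rho> / 4)) / 2"
      by (simp add: algebra_simps add_divide_distrib)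
    then have "0 \<le> (Q x + Q y) / 2 - ln \<bar>x - y\<bar> + K"
      using b[of x] b[of y] square[of x] square[of y]
      by (simp add: K_def field_simps)
    then show ?thesis by simp
  qed
  \<comment> \<open>The maximum with 0 secures \<open>C_nonneg\<close>.\<close>
  then have "strongly_convex_potential Q \<rho> (max 0 K)"
    using assms by unfold_locales auto
  then show ?thesis ..
qed

theorem theorem2p4:
  fixes \<rho> :: real and Q :: "real \<Rightarrow> real"
  assumes "\<rho> > 0"
    and "convex_on UNIV (\<lambda>x. Q x - \<rho> * x\<^sup>2)"
  shows "(\<forall>\<mu>Q\<in>prob_measures. energy Q \<mu>Q = min_energy Q \<longrightarrow>
            (\<forall>\<mu>\<in>prob_measures.
               ereal \<rho> * (enn2ereal (W2 \<mu> \<mu>Q))\<^sup>2 \<le> energy Q \<mu> - min_energy Q)) \<and>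
         (\<exists>!\<mu>. \<mu> \<in> prob_measures \<and> energy Q \<mu> = min_energy Q)"
proof -
  obtain C where "strongly_convex_potential Q \<rho> C"
    using ex_strongly_convex_potential[OF assms] by blast
  then interpret strongly_convex_potential Q \<rho> C .
  obtain \<mu>\<^sub>0 where \<mu>\<^sub>0: "\<mu>\<^sub>0 \<in> prob_measures" "shifted_energy \<mu>\<^sub>0 < \<infinity>"
    and minimal: "\<And>\<nu>. \<nu> \<in> prob_measures \<Longrightarrow> shifted_energy \<mu>\<^sub>0 \<le> shifted_energy \<nu>"
    using ex_minimizer by blast
  have min_energy: "min_energy Q = energy Q \<mu>\<^sub>0"
    unfolding min_energy_def using \<mu>\<^sub>0 minimal
    by (intro antisym INF_lower INF_greatest) (auto simp: energy_le_iff)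
  have minimizer_iff: "energy Q \<mu> = min_energy Q \<longleftrightarrow> shifted_energy \<mu> = shifted_energy \<mu>\<^sub>0"
    if "\<mu> \<in> prob_measures" for \<mu>
    using that \<mu>\<^sub>0(1) by (auto simp: min_energy energy_le_iff order_eq_iff)
  show ?thesis
  proof (intro conjI ballI impI ex_ex1I)
    \<comment> \<open>By \<open>minimizer_iff\<close> an arbitrary minimizer shares the shifted
      energy of \<open>\<mu>\<^sub>0\<close> and so inherits its minimality and finiteness.\<close>
    fix \<mu>Q \<mu> assume "\<mu>Q \<in> prob_measures" "energy Q \<mu>Q = min_energy Q" "\<mu> \<in> prob_measures"
    then show "ereal \<rho> * (enn2ereal (W2 \<mu> \<mu>Q))\<^sup>2 \<le> energy Q \<mu> - min_energy Q"
      using transport_inequality[of \<mu>Q \<mu>] minimal \<mu>\<^sub>0 minimizer_iff by metis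
  next
    show "\<exists>\<mu>. \<mu> \<in> prob_measures \<and> energy Q \<mu> = min_energy Q"
      using \<mu>\<^sub>0(1) min_energy by metis
  next
    fix \<mu> \<nu>
    assume "\<mu> \<in> prob_measures \<and> energy Q \<mu> = min_energy Q"
      "\<nu> \<in> prob_measures \<and> energy Q \<nu> = min_energy Q"
    then show "\<mu> = \<nu>"
      using minimizer_iff minimal \<mu>\<^sub>0 by (intro minimizer_unique) auto
  qed
qed

end
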